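(* Let $R\bowtie^{f}J$ be the amalgamation of commutative semirings $R$ and $R'$ along the ideal $J$ of $R'$ with respect to a semiring homomorphism $f:R\to R'$. Let $S$ be a multiplicatively closed subset of $R$ and let $I$ be an ideal of $R$ with $I\cap S=\emptyset$. Then: (i) If $I\bowtie^{f}J$ is a quasi $S'$-$n$-ideal of $R\bowtie^{f}J$, then $I\bowtie^{f}J$ is a quasi $(S\bowtie^{f}J)$-$n$-ideal of $R\bowtie^{f}J$. (ii) If $I\bowtie^{f}J$ is a quasi $(S\bowtie^{f}J)$-$n$-ideal of $R\bowtie^{f}J$, then $I$ is a quasi $S$-$n$-ideal of $R$.
   Context: All semirings are commutative with identity $1\neq 0$. A subset $S$ of a semiring is multiplicatively closed if $0\notin S$, $1\in S$, and $st\in S$ for all $s,t\in S$. $N(R)$ denotes the nilradical (set of nilpotent elements) of $R$. A proper ideal $I$ of $R$ with $I\cap S=\emptyset$ is a quasi $S$-$n$-ideal of $R$ if there exists a fixed element $s\in S$ such that, for all $a,b\in R$, $ab\in I$ implies $sa^2\in I$ or $sb\in N(R)$. For a semiring homomorphism $f:R\to R'$ and an ideal $J$ of $R'$, the amalgamation is the subsemiring $R\bowtie^{f}J=\{(a,f(a)+j): a\in R, j\in J\}$ of $R\times R'$. For an ideal $I$ of $R$, $I\bowtie^{f}J=\{(i,f(i)+j): i\in I, j\in J\}$, an ideal of $R\bowtie^{f}J$. For a multiplicatively closed $S\subseteq R$, the sets $S\bowtie^{f}J=\{(s,f(s)+j): s\in S, j\in J\}$ and $S'=\{(s,f(s)):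 s\in S\}$ are multiplicatively closed subsets of $R\bowtie^{f}J$. *)

theory Defs
  imports "HOL-Algebra.Algebra"
begin

locale csemiring = semiring R + comm_monoid R for R (structure) +
  assumes one_not_zero: "\<one> \<noteq> \<zero>"

locale csemiring_ideal = csemiring R for I and R (structure) +
  assumes add_submonoid: "submonoid I (add_monoid R)"
    and m_absorb: "\<lbrakk> x \<in> I; r \<in> carrier R \<rbrakk> \<Longrightarrow> r \<otimes> x \<in> I"

text \<open>
  The library's \<^const>\<open>ring_hom\<close> does not mention zero, because preservation of zero is
  automatic for rings. This is not so for semirings, so it is required here.
\<close>

definition semiring_hom ::
    "('a, 'm) ring_scheme \<Rightarrow> ('b, 'n) ring_scheme \<Rightarrow> ('a \<Rightarrow> 'b) set"
  where "semiring_hom R R' = {f \<in> ring_hom R R'. f \<zero>\<^bsub>R\<^esub> = \<zero>\<^bsub>R'\<^esub>}"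

definition mult_closed :: "'a set \<Rightarrow> ('a, 'm) ring_scheme \<Rightarrow> bool"
  where "mult_closed S R \<longleftrightarrow> submonoid S R \<and> \<zero>\<^bsub>R\<^esub> \<notin> S"

definition nilradical :: "('a, 'm) ring_scheme \<Rightarrow> 'a set"
  where "nilradical R = {x \<in> carrier R. \<exists>n::nat. n > 0 \<and> x [^]\<^bsub>R\<^esub> n = \<zero>\<^bsub>R\<^esub>}"

locale quasi_S_n_ideal = csemiring_ideal I R for S and I and R (structure) +
  assumes S_mult_closed: "mult_closed S R"
    and proper: "I \<noteq> carrier R"
    and disjoint: "I \<inter> S = {}"
    and quasi: "\<exists>s\<in>S. \<forall>a\<in>carrier R. \<forall>b\<in>carrier R.
                  a \<otimes> b \<in> I \<longrightarrow> s \<otimes> a [^] (2::nat) \<in> I \<or> s \<otimes> b \<in> nilradical R"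

text \<open>
  For a subset \<open>A\<close> of \<open>R\<close>, the set \<open>A \<bowtie>\<^sup>f J\<close>. It is used for \<open>A = R\<close> (giving the
  carrier of the amalgamation), for \<open>A = I\<close> and for \<open>A = S\<close>.
\<close>

definition amalg_set ::
    "('b, 'n) ring_scheme \<Rightarrow> ('a \<Rightarrow> 'b) \<Rightarrow> 'a set \<Rightarrow> 'b set \<Rightarrow> ('a \<times> 'b) set"
  where "amalg_set R' f A J = {(a, f a \<oplus>\<^bsub>R'\<^esub> j) | a j. a \<in> A \<and> j \<in> J}"

definition amalgamation ::
    "('a, 'm) ring_scheme \<Rightarrow> ('b, 'n) ring_scheme \<Rightarrow> ('a \<Rightarrow> 'b) \<Rightarrow> 'b set \<Rightarrow> ('a \<times> 'b) ring"
  where "amalgamation R R' f J = (RDirProd R R')\<lparr>carrier := amalg_set R' f (carrier R) J\<rparr>"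

definition graph_set :: "('a \<Rightarrow> 'b) \<Rightarrow> 'a set \<Rightarrow> ('a \<times> 'b) set"
  where "graph_set f S = {(s, f s) | s. s \<in> S}"

end

theory Submission
  imports Defs
begin

text \<open>
  In the amalgamation the ideal \<open>I \<bowtie>\<^sup>f J\<close> is the full preimage of \<open>I\<close> under the first
  projection, and this drives both implications.

  For (i), a witness for \<open>S'\<close> is also a witness for any larger multiplicatively closed set that
  still misses the ideal. Since \<open>0 \<in> J\<close>, the graph \<open>S'\<close> lies in \<open>S \<bowtie>\<^sup>f J\<close>. The set
  \<open>S \<bowtie>\<^sup>f J\<close> is closed under products because \<open>J\<close> absorbs the cross terms
  (lemma \<open>amalg_set_submonoid\<close>), and it avoids both zero and \<open>I \<bowtie>\<^sup>f J\<close> because \<open>S\<close> avoids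
  both zero and \<open>I\<close> in the first coordinate.

  For (ii), a product \<open>a b \<in> I\<close> lifts along the graph map \<open>x \<mapsto> (x, f x)\<close> to a product in
  \<open>I \<bowtie>\<^sup>f J\<close>. A witness \<open>(s, f s + j)\<close> applies there, and projecting its conclusion to the first
  coordinate shows that \<open>s\<close> is a witness for \<open>I\<close>: the projection preserves products, powers and
  hence nilpotency (lemma \<open>fst_nilradical_amalgamation\<close>).
\<close>

lemma amalgamation_simps:
  "carrier (amalgamation R R' f J) = amalg_set R' f (carrier R) J"
  "p \<otimes>\<^bsub>amalgamation R R' f J\<^esub> q = (fst p \<otimes>\<^bsub>R\<^esub> fst q, snd p \<otimes>\<^bsub>R'\<^esub> snd q)"
  "\<one>\<^bsub>amalgamation R R' f J\<^esub> = (\<one>\<^bsub>R\<^esub>, \<one>\<^bsub>R'\<^esub>)"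
  "\<zero>\<^bsub>amalgamation R R' f J\<^esub> = (\<zero>\<^bsub>R\<^esub>, \<zero>\<^bsub>R'\<^esub>)"
  by (simp_all add: amalgamation_def RDirProd_def DirProd_def monoid.defs split: prod.splits)

lemma fst_amalgamation_nat_pow:
  "fst (p [^]\<^bsub>amalgamation R R' f J\<^esub> (n::nat)) = fst p [^]\<^bsub>R\<^esub> n"
  by (induction n) (simp_all add: amalgamation_simps nat_pow_def)

lemma fst_amalg_set: "p \<in> amalg_set R' f A J \<Longrightarrow> fst p \<in> A"
  by (auto simp: amalg_set_def)

lemma fst_nilradical_amalgamation:
  assumes "p \<in> nilradical (amalgamation R R' f J)"
  shows "fst p \<in> nilradical R"
proof -
  obtain n :: nat where p: "p \<in> carrier (amalgamation R R' f J)" and n: "n > 0"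
    "p [^]\<^bsub>amalgamation R R' f J\<^esub> n = \<zero>\<^bsub>amalgamation R R' f J\<^esub>"
    using assms by (auto simp: nilradical_def)
  have "fst p [^]\<^bsub>R\<^esub> n = \<zero>\<^bsub>R\<^esub>"
    using arg_cong[OF n(2), of fst] by (simp add: fst_amalgamation_nat_pow amalgamation_simps)
  moreover have "fst p \<in> carrier R"
    using p by (simp add: amalgamation_simps fst_amalg_set)
  ultimately show ?thesis
    using n(1) by (auto simp: nilradical_def)
qed

lemma graph_mem_amalg_set:
  assumes "csemiring_ideal J R'" "f a \<in> carrier R'" "a \<in> A"
  shows "(a, f a) \<in> amalg_set R' f A J"
proof -
  interpret J: csemiring_ideal J R' by fact
  have "\<zero>\<^bsub>R'\<^esub> \<in> J"
    using submonoid.one_closed[OF J.add_submonoid] by simp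
  then show ?thesis
    using assms(2,3) by (force simp: amalg_set_def)
qed

text \<open>
  Since \<open>(f s + j) (f t + k) = f (s t) + (f s k + j f t + j k)\<close> and the bracket lies in the ideal
  \<open>J\<close>, products of amalgamated elements are again amalgamated.
\<close>

lemma amalg_set_submonoid:
  assumes R: "csemiring R" and J: "csemiring_ideal J R'"
    and f: "f \<in> ring_hom R R'" and S: "submonoid S R"
  shows "submonoid (amalg_set R' f S J) (amalgamation R R' f J)"
proof -
  interpret R: csemiring R by fact
  interpret J: csemiring_ideal J R' by fact
  interpret S: submonoid S R by fact
  interpret add_J: submonoid J "add_monoid R'" by (rule J.add_submonoid)
  have J_carrier: "j \<in> carrier R'" if "j \<in> J" for j
    using add_J.subset that by auto
  have J_add: "j \<oplus>\<^bsub>R'\<^esub> k \<in> J" if "j \<in> J" "k \<in> J" for j k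
    using add_J.m_closed that by simp
  have f_carrier: "f a \<in> carrier R'" if "a \<in> carrier R" for a
    using f that by (rule ring_hom_closed)
  have S_carrier: "s \<in> carrier R" if "s \<in> S" for s
    using S.subset that by auto
  show ?thesis
  proof
    show "amalg_set R' f S J \<subseteq> carrier (amalgamation R R' f J)"
      using S_carrier by (auto simp: amalgamation_simps amalg_set_def)
    show "\<one>\<^bsub>amalgamation R R' f J\<^esub> \<in> amalg_set R' f S J"
      using graph_mem_amalg_set[where f = f, OF J f_carrier S.one_closed] ring_hom_one[OF f]
      by (simp add: amalgamation_simps)
  next
    fix p q
    assume "p \<in> amalg_set R' f S J" "q \<in> amalg_set R' f S J"
    then obtain s j t k where st: "s \<in> S" "t \<in> S" and jk: "j \<in> J" "k \<in> J"
      and p: "p = (s, f s \<oplus>\<^bsub>R'\<^esub> j)" and q: "q = (t, f t \<oplus>\<^bsub>R'\<^esub> k)"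
      unfolding amalg_set_def by blast
    define l where "l = f s \<otimes>\<^bsub>R'\<^esub> k \<oplus>\<^bsub>R'\<^esub> (f t \<otimes>\<^bsub>R'\<^esub> j \<oplus>\<^bsub>R'\<^esub> k \<otimes>\<^bsub>R'\<^esub> j)"
    have car: "f s \<in> carrier R'" "f t \<in> carrier R'" "j \<in> carrier R'" "k \<in> carrier R'"
      using st jk S_carrier f_carrier J_carrier by auto
    have "l \<in> J"
      unfolding l_def using jk car by (intro J_add J.m_absorb)
    moreover have "(f s \<oplus>\<^bsub>R'\<^esub> j) \<otimes>\<^bsub>R'\<^esub> (f t \<oplus>\<^bsub>R'\<^esub> k) = f (s \<otimes>\<^bsub>R\<^esub> t) \<oplus>\<^bsub>R'\<^esub> l"
      using car st S_carrier ring_hom_mult[OF f]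
      by (simp add: l_def J.l_distr J.r_distr J.a_ac J.m_ac)
    ultimately show "p \<otimes>\<^bsub>amalgamation R R' f J\<^esub> q \<in> amalg_set R' f S J"
      using S.m_closed[OF st] by (auto simp: p q amalgamation_simps amalg_set_def)
  qed
qed

text \<open>
  The element witnessing the quasi condition may be kept when the multiplicatively closed set
  grows.
\<close>

lemma quasi_S_n_ideal_mono:
  assumes "quasi_S_n_ideal S I R" "S \<subseteq> T" "mult_closed T R" "I \<inter> T = {}"
  shows "quasi_S_n_ideal T I R"
proof -
  interpret quasi_S_n_ideal S I R by fact
  show ?thesis
    by unfold_locales (use assms(2-4) proper quasi in blast)+
qed

theorem theorem3p4:
  fixes R :: "('a, 'm) ring_scheme" and R' :: "('b, 'n) ring_scheme"
    and f :: "'a \<Rightarrow> 'b" and J :: "'b set" and S I :: "'a set"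
  assumes "csemiring R" and "csemiring R'"
    and "f \<in> semiring_hom R R'"
    and "csemiring_ideal J R'"
    and "mult_closed S R"
    and "csemiring_ideal I R"
    and "I \<inter> S = {}"
  shows "(quasi_S_n_ideal (graph_set f S) (amalg_set R' f I J) (amalgamation R R' f J) \<longrightarrow>
            quasi_S_n_ideal (amalg_set R' f S J) (amalg_set R' f I J) (amalgamation R R' f J)) \<and>
         (quasi_S_n_ideal (amalg_set R' f S J) (amalg_set R' f I J) (amalgamation R R' f J) \<longrightarrow>
            quasi_S_n_ideal S I R)"
proof (intro conjI impI)
  interpret R: csemiring R by fact
  interpret I: csemiring_ideal I R by fact
  have f: "f \<in> ring_hom R R'"
    using assms(3) by (simp add: semiring_hom_def)
  have S: "submonoid S R" "\<zero>\<^bsub>R\<^esub> \<notin> S"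
    using assms(5) by (simp_all add: mult_closed_def)
  have S_carrier: "S \<subseteq> carrier R"
    using S(1) by (rule submonoid.subset)
  have graph: "(a, f a) \<in> amalg_set R' f A J" if "a \<in> A" "A \<subseteq> carrier R" for a A
    using that by (intro graph_mem_amalg_set[OF assms(4)] ring_hom_closed[OF f]) auto
  let ?A = "amalgamation R R' f J"
  {
    assume "quasi_S_n_ideal (graph_set f S) (amalg_set R' f I J) ?A"
    moreover have "graph_set f S \<subseteq> amalg_set R' f S J"
      using graph S_carrier by (auto simp: graph_set_def)
    moreover have "mult_closed (amalg_set R' f S J) ?A"
      using amalg_set_submonoid[OF assms(1,4) f S(1)] S(2)
      by (auto simp: mult_closed_def amalgamation_simps dest: fst_amalg_set)
    moreover have "amalg_set R' f I J \<inter> amalg_set R' f S J = {}"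
      using assms(7) fst_amalg_set by fastforce
    ultimately show "quasi_S_n_ideal (amalg_set R' f S J) (amalg_set R' f I J) ?A"
      by (rule quasi_S_n_ideal_mono)
  next
    assume "quasi_S_n_ideal (amalg_set R' f S J) (amalg_set R' f I J) ?A"
    then interpret Q: quasi_S_n_ideal "amalg_set R' f S J" "amalg_set R' f I J" ?A .
    obtain w where w: "w \<in> amalg_set R' f S J"
      and quasi: "\<And>p q. \<lbrakk>p \<in> carrier ?A; q \<in> carrier ?A; p \<otimes>\<^bsub>?A\<^esub> q \<in> amalg_set R' f I J\<rbrakk> \<Longrightarrow>
        w \<otimes>\<^bsub>?A\<^esub> p [^]\<^bsub>?A\<^esub> (2::nat) \<in> amalg_set R' f I J \<or> w \<otimes>\<^bsub>?A\<^esub> q \<in> nilradical ?A"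
      using Q.quasi by blast
    have I_carrier: "I \<subseteq> carrier R"
      using submonoid.subset[OF I.add_submonoid] by simp
    have witness: "fst w \<otimes>\<^bsub>R\<^esub> a [^]\<^bsub>R\<^esub> (2::nat) \<in> I \<or> fst w \<otimes>\<^bsub>R\<^esub> b \<in> nilradical R"
      if ab: "a \<in> carrier R" "b \<in> carrier R" "a \<otimes>\<^bsub>R\<^esub> b \<in> I" for a b
    proof -
      have "(a, f a) \<otimes>\<^bsub>?A\<^esub> (b, f b) \<in> amalg_set R' f I J"
        using graph[OF ab(3) I_carrier] ring_hom_mult[OF f ab(1,2)]
        by (simp add: amalgamation_simps)
      then have "w \<otimes>\<^bsub>?A\<^esub> (a, f a) [^]\<^bsub>?A\<^esub> (2::nat) \<in> amalg_set R' f I J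
          \<or> w \<otimes>\<^bsub>?A\<^esub> (b, f b) \<in> nilradical ?A"
        using ab graph by (intro quasi) (simp_all add: amalgamation_simps)
      then show ?thesis
        by (auto dest!: fst_amalg_set fst_nilradical_amalgamation
            simp: amalgamation_simps(2) fst_amalgamation_nat_pow)
    qed
    have "I \<noteq> carrier R"
      using submonoid.one_closed[OF S(1)] assms(7) by auto
    then show "quasi_S_n_ideal S I R"
      using assms(5,7) witness fst_amalg_set[OF w] by unfold_locales blast+
  }
qed

end
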